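(* Let $X$ be a real random variable with variance $\sigma^2$, $\sigma>0$, and let $U$ be a uniform random variable on $[0,1]$ independent of $X$. Then for any $k>0$, $$P\left(X-\mathbb E X\ge\sqrt U\,\Big(k\sigma+\frac{\sigma}{k}\Big)-\frac{\sigma}{k}\right)\le\frac1{k^2+1}.$$ *)

theory Defs
  imports "HOL-Probability.Probability"
begin

end

theory Submission
  imports Defs
begin

text \<open>
  Put \<open>Z = (X - E X + b) / a\<close> with \<open>a = k \<sigma> + \<sigma> / k\<close> and \<open>b = \<sigma> / k\<close>. The event says \<open>sqrt U \<le> Z\<close>,
  hence \<open>U \<le> Z\<^sup>2\<close>. Conditionally on \<open>X\<close> the latter has probability at most \<open>Z\<^sup>2\<close>, and
  \<open>E Z\<^sup>2 = (\<sigma>\<^sup>2 + b\<^sup>2) / a\<^sup>2 = 1 / (k\<^sup>2 + 1)\<close>.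
\<close>

text \<open>Equality holds up to \<open>w = 1\<close>; beyond that the mass stays 1 while
  \<open>w\<close> grows. Keeping only the inequality covers both ranges at once, so thresholds
  above 1 need no truncation later.\<close>

lemma emeasure_uniform_unit_interval_atMost_le:
  fixes w :: real
  assumes "w \<ge> 0"
  shows "emeasure (uniform_measure lborel {0..1}) {..w} \<le> ennreal w"
proof -
  have "emeasure (uniform_measure lborel {0..1}) {..w}
      = emeasure lborel ({0..1} \<inter> {..w}) / emeasure lborel {0..1::real}"
    by (rule emeasure_uniform_measure) auto
  also have "\<dots> = emeasure lborel ({0..1} \<inter> {..w})"
    by (simp add: divide_ennreal_def)
  also have "\<dots> \<le> emeasure lborel {0..w}"
    by (rule emeasure_mono) auto
  also have "\<dots> = ennreal w"
    using assms by simp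
  finally show ?thesis .
qed

text \<open>Independence turns the joint law of \<open>(X, U)\<close> into a product, so Tonelli
  computes the probability by slicing at fixed \<open>x\<close>. Each slice is a half-line
  \<open>{..f x}\<close>, whose uniform mass is at most \<open>f x\<close>; integrating over the law
  of \<open>X\<close> gives the expectation.\<close>

lemma (in prob_space) prob_uniform_le_indep_le_expectation:
  fixes X U f :: "_ \<Rightarrow> real"
  assumes indep: "indep_var borel X borel U"
    and U: "distr M borel U = uniform_measure lborel {0..1}"
    and f [measurable]: "f \<in> borel_measurable borel" and nonneg: "\<And>x. f x \<ge> 0"
    and int: "integrable M (\<lambda>\<omega>. f (X \<omega>))"
  shows "\<P>(\<omega> in M. U \<omega> \<le> f (X \<omega>)) \<le> expectation (\<lambda>\<omega>. f (X \<omega>))"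
proof -
  have [measurable]: "random_variable borel X" "random_variable borel U"
    using indep by (blast dest: indep_var_rv1 indep_var_rv2)+
  interpret U: prob_space "distr M borel U"
    by (rule prob_space_distr) simp
  define A where "A = {p \<in> space (borel \<Otimes>\<^sub>M borel). snd p \<le> f (fst p)}"
  have A: "A \<in> sets (borel \<Otimes>\<^sub>M borel)"
    unfolding A_def by measurable
  have "emeasure M {\<omega> \<in> space M. U \<omega> \<le> f (X \<omega>)}
      = emeasure (distr M (borel \<Otimes>\<^sub>M borel) (\<lambda>\<omega>. (X \<omega>, U \<omega>))) A"
    by (subst emeasure_distr[OF _ A])
       (auto simp: A_def space_pair_measure intro!: arg_cong[where f = "emeasure M"])
  also have "\<dots> = emeasure (distr M borel X \<Otimes>\<^sub>M distr M borel U) A"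
    using indep by (simp add: indep_var_distribution_eq)
  also have "\<dots> = (\<integral>\<^sup>+ x. emeasure (distr M borel U) (Pair x -` A) \<partial>distr M borel X)"
    by (rule U.emeasure_pair_measure_alt) (use A in simp)
  also have "\<dots> \<le> (\<integral>\<^sup>+ x. ennreal (f x) \<partial>distr M borel X)"
  proof (rule nn_integral_mono)
    fix x :: real
    have "Pair x -` A = {..f x}"
      by (auto simp: A_def space_pair_measure)
    then show "emeasure (distr M borel U) (Pair x -` A) \<le> ennreal (f x)"
      using emeasure_uniform_unit_interval_atMost_le[OF nonneg] by (simp add: U)
  qed
  also have "\<dots> = (\<integral>\<^sup>+ \<omega>. ennreal (f (X \<omega>)) \<partial>M)"
    by (rule nn_integral_distr) simp_all
  also have "\<dots> = ennreal (expectation (\<lambda>\<omega>. f (X \<omega>)))"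
    by (rule nn_integral_eq_integral[OF int]) (simp add: nonneg)
  finally show ?thesis
    by (simp add: emeasure_eq_measure nonneg)
qed

theorem mainTheorem15:
  fixes M :: "'a measure" and X U :: "'a \<Rightarrow> real" and \<sigma> k :: real
  assumes "prob_space M"
    and "X \<in> borel_measurable M" and "integrable M (\<lambda>\<omega>. (X \<omega>)\<^sup>2)"
    and "prob_space.variance M X = \<sigma>\<^sup>2" and "\<sigma> > 0"
    and "U \<in> borel_measurable M"
    and "distr M borel U = uniform_measure lborel {0..1}"
    and "prob_space.indep_var M borel X borel U"
    and "k > 0"
  shows "\<P>(\<omega> in M. X \<omega> - prob_space.expectation M X \<ge> sqrt (U \<omega>) * (k * \<sigma> + \<sigma> / k) - \<sigma> / k)
    \<le> 1 / (k\<^sup>2 + 1)"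
proof -
  interpret prob_space M by fact
  note [measurable] = assms(2,6)
  define \<mu> where "\<mu> = expectation X"
  define a where "a = k * \<sigma> + \<sigma> / k"
  define b where "b = \<sigma> / k"
  define f where "f x = ((x - \<mu> + b) / a)\<^sup>2" for x
  have a: "a > 0"
    unfolding a_def using assms(5,9) by (simp add: add_pos_pos)
  have f [measurable]: "f \<in> borel_measurable borel"
    unfolding f_def by measurable
  have int_X: "integrable M X"
    by (rule square_integrable_imp_integrable) fact+
  have int_var: "integrable M (\<lambda>\<omega>. (X \<omega> - \<mu>)\<^sup>2)"
    unfolding power2_diff using int_X assms(3) by auto
  \<comment> \<open>Expanding around the centred variable \<open>X \<omega> - \<mu>\<close> makes
    the cross term vanish in expectation, leaving only the variance and the constant
    \<open>b\<^sup>2\<close>.\<close>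
  have f_expand: "f (X \<omega>) = ((X \<omega> - \<mu>)\<^sup>2 + 2 * b * (X \<omega> - \<mu>) + b\<^sup>2) / a\<^sup>2" for \<omega>
    unfolding f_def power_divide by (simp add: power2_eq_square algebra_simps)
  have int_f: "integrable M (\<lambda>\<omega>. f (X \<omega>))"
    unfolding f_expand using int_X int_var by simp
  have "expectation (\<lambda>\<omega>. f (X \<omega>)) = (\<sigma>\<^sup>2 + b\<^sup>2) / a\<^sup>2"
    unfolding f_expand using int_X int_var assms(4) by (simp add: prob_space \<mu>_def)
  also have "\<dots> = 1 / (k\<^sup>2 + 1)"
  proof -
    \<comment> \<open>Both identities come from \<open>\<sigma> = k * b\<close>. They reduce the
      quotient to \<open>b\<^sup>2 * (k\<^sup>2 + 1) / (b * (k\<^sup>2 + 1))\<^sup>2\<close>, where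
      \<open>b\<close> cancels.\<close>
    have "a = b * (k\<^sup>2 + 1)" "\<sigma>\<^sup>2 + b\<^sup>2 = b\<^sup>2 * (k\<^sup>2 + 1)"
      unfolding a_def b_def using assms(9) by (simp_all add: field_simps power2_eq_square)
    moreover have "b > 0" "k\<^sup>2 + 1 > 0"
      unfolding b_def using assms(5,9) by (simp_all add: add_pos_pos)
    ultimately show ?thesis
      by (simp add: power_mult_distrib power2_eq_square)
  qed
  finally have exp_f: "expectation (\<lambda>\<omega>. f (X \<omega>)) = 1 / (k\<^sup>2 + 1)" .
  \<comment> \<open>Squaring is safe for either sign of \<open>U \<omega>\<close>: if it is
    nonnegative, the right-hand side dominates a nonnegative root; if it is negative, it lies below
    any square.\<close>
  have "U \<omega> \<le> f (X \<omega>)" if "X \<omega> - \<mu> \<ge> sqrt (U \<omega>) * a - b" for \<omega>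
  proof -
    have "sqrt (U \<omega>) \<le> (X \<omega> - \<mu> + b) / a"
      using that a by (simp add: field_simps)
    then show ?thesis
      unfolding f_def by (rule sqrt_le_D)
  qed
  then have "\<P>(\<omega> in M. X \<omega> - \<mu> \<ge> sqrt (U \<omega>) * a - b) \<le> \<P>(\<omega> in M. U \<omega> \<le> f (X \<omega>))"
    by (intro finite_measure_mono) auto
  also have "\<dots> \<le> 1 / (k\<^sup>2 + 1)"
    using prob_uniform_le_indep_le_expectation[OF assms(8,7) f _ int_f] exp_f
    by (simp add: f_def)
  finally show ?thesis
    unfolding a_def b_def \<mu>_def .
qed

end
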